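(* Let $F$ be strongly convex with parameter $\mu_F>0$ over $\mathscr B$ with respect to $\|\cdot\|$, and let $\beta^*$ be its unique minimizer over $\mathscr B$. Suppose the stochastic subgradients $\tilde g(\beta)\in\partial f(\beta,\xi)$ satisfy, a.s. for all $\beta\in\mathscr B$, $\mathbb E[\tilde g(\beta)\mid\beta]=\mathbf g(\beta)\in\partial F(\beta)$, and for each $i=1,\dots,l$ there is a scalar $C_i>0$ with $\mathbb E[\|\tilde g_i(\beta)\|_{*i}^2\mid\beta]\le C_i^2$ for all $\beta\in\mathscr B$. Let $\{\beta_t\}$ be generated by the randomized block subgradient stochastic mirror descent scheme with stepsizes $\eta_t>0$: $\beta_{t+1}^{i}=\mathcal P_{i_t}(\beta_t^{i_t},\eta_t\tilde g_{i_t}(\beta_t))$ if $i=i_t$, and $\beta_{t+1}^i=\beta_t^i$ if $i\ne i_t$. Then for all $t\ge 0$, $$\mathbb E[\mathcal L(\beta_{t+1},\beta^* )\mid\mathcal F_t]\le\left(1-\eta_t\frac{2\mu_F p_\wedge}{\mathfrak L_{max}}\right)\mathcal L(\beta_t,\beta^* )+\eta_t^2\sum_{i=1}^l\frac{C_i^2}{2\mu_{\omega_i}}.$$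
   Context: Problem: minimize $F(\beta):=\mathbb E[f(\beta,\xi)]$ over $\beta\in\mathscr B=\prod_{i=1}^l\mathscr B_i\subset\mathbb R^n$, with $\mathscr B_i\subset\mathbb R^{n_i}$ nonempty, closed, convex, $n=\sum_i n_i$, $f:\mathscr B\times\Omega\to\mathbb R$, and $\xi:\Omega\to\mathbb R^d$ a random vector on a probability space. $F$ is a (possibly nondifferentiable) convex function; $\mathbf g\in\partial F(\beta)$ means $F(\beta)+\langle\mathbf g,\beta'-\beta\rangle\le F(\beta')$ for all $\beta'\in\mathscr B$, and $\partial f(\beta,\xi)$ denotes the subgradients of $f(\cdot,\xi)$ at $\beta$ in the same sense. Norms: $\beta^i\in\mathbb R^{n_i}$ is the $i$th block of $\beta$, and a subscript $i$ denotes the $i$th block of a mapping into $\mathbb R^n$. $\|\cdot\|_i$ is a general norm on $\mathbb R^{n_i}$ with dual norm $\|\cdot\|_{*i}$; $\langle u,v\rangle=\sum_i\langle u^i,v^i\rangle$; $\|x\|^2=\sum_{i=1}^l\|x^i\|_i^2$. $F$ strongly convex with parameter $\mu_F$: $F(\beta_1)\ge F(\beta_2)+\langle\mathbf g,\beta_1-\beta_2\rangle+\frac{\mu_F}{2}\|\beta_1-\beta_2\|^2$ for all $\beta_1,\beta_2\in\mathscr B$, $\mathbf g\in\partial F(\beta_2)$ (then $F$ has a unique minimizer over $\mathscr B$). Mirror maps: $\omega_i:\mathbb R^{n_i}\to\mathbb R$ is continuously differentiable, with Bregman divergence $D_i(\beta_1,\beta_2)=D_{\omega_i}(\beta_1,\beta_2)=\omega_i(\beta_2)-\omega_i(\beta_1)-\langle\nabla\omega_i(\beta_1),\beta_2-\beta_1\rangle$.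 It is assumed that $\omega_i$ has Lipschitz gradients with parameter $\mathfrak L_{\omega_i}$ and is strongly convex with parameter $\mu_{\omega_i}>0$, i.e. $\frac{\mu_{\omega_i}}2\|\beta_2-\beta_1\|_i^2\le D_{\omega_i}(\beta_1,\beta_2)\le\frac{\mathfrak L_{\omega_i}}2\|\beta_2-\beta_1\|_i^2$ for $\beta_1,\beta_2\in\mathscr B_i$. Prox mapping: $\mathcal P_i(\beta_1,\beta_2)=\operatorname{argmin}_{z\in\mathscr B_i}\{\langle\beta_2,z\rangle+D_i(\beta_1,z)\}$ for $\beta_1\in\mathscr B_i$, $\beta_2\in\mathbb R^{n_i}$. Error function: $\mathcal L(\beta,z)=\sum_{i=1}^l p_i^{-1}D_i(\beta^i,z^i)$. Sampling: $p_i>0$, $\sum_{i=1}^l p_i=1$; the initial vector $\beta_0\in\mathscr B$ is given; at iteration $t$ the block index $i_t$ is drawn with $\mathrm{Prob}(i_t=i)=p_i$, independently of $\xi_t$ and of the past; $\xi_t$ is a copy of $\xi$ independent of the past; $\tilde g(\beta_t)\in\partial f(\beta_t,\xi_t)$. The stepsizes are deterministic. $\mathcal F_t=\{i_0,\xi_0,\dots,i_{t-1},\xi_{t-1}\}$. $p_\wedge=\min_i p_i$, $\mathfrak L_{max}=\max_i\mathfrak L_{\omega_i}$. *)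

theory Defs
  imports "HOL-Probability.Probability"
begin

(* The decomposition of R^n into R^{n_1} x ... x R^{n_l} is encoded by a map b that sends each
   coordinate k to the (label of the) block containing it, so n_i = card {k. b k = i}.
   The factor R^{n_i} is identified with the coordinate subspace block_space b i of R^n, and the
   i-th block of x with its coordinate projection block b i x.  Under this identification the
   inner product is the one of R^n, and x \<bullet> y is the sum of the blockwise inner products. *)

definition block :: "('n \<Rightarrow> 'l) \<Rightarrow> 'l \<Rightarrow> real ^ 'n \<Rightarrow> real ^ 'n" where
  "block b i x = (\<chi> k. if b k = i then x $ k else 0)"

definition block_space :: "('n \<Rightarrow> 'l) \<Rightarrow> 'l \<Rightarrow> (real ^ 'n) set" where
  "block_space b i = {x. \<forall>k. b k \<noteq> i \<longrightarrow> x $ k = 0}"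

definition block_prod :: "('n \<Rightarrow> 'l) \<Rightarrow> ('l \<Rightarrow> (real ^ 'n) set) \<Rightarrow> (real ^ 'n) set" where
  "block_prod b B = {x. \<forall>i. block b i x \<in> B i}"

definition is_norm_on :: "'v::real_vector set \<Rightarrow> ('v \<Rightarrow> real) \<Rightarrow> bool" where
  "is_norm_on E N \<longleftrightarrow>
     (\<forall>x\<in>E. N x \<ge> 0 \<and> (N x = 0 \<longleftrightarrow> x = 0)) \<and>
     (\<forall>c. \<forall>x\<in>E. N (c *\<^sub>R x) = \<bar>c\<bar> * N x) \<and>
     (\<forall>x\<in>E. \<forall>y\<in>E. N (x + y) \<le> N x + N y)"

definition dual_norm :: "'v::real_inner set \<Rightarrow> ('v \<Rightarrow> real) \<Rightarrow> 'v \<Rightarrow> real" where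
  "dual_norm E N u = (SUP v\<in>{v \<in> E. N v \<le> 1}. u \<bullet> v)"

definition total_norm ::
    "('n \<Rightarrow> 'l::finite) \<Rightarrow> ('l \<Rightarrow> real ^ 'n \<Rightarrow> real) \<Rightarrow> real ^ 'n \<Rightarrow> real" where
  "total_norm b N x = sqrt (\<Sum>i\<in>UNIV. (N i (block b i x))\<^sup>2)"

(* The subgradient inequality is only required on S, as S is the domain of F. *)
definition subdiff :: "'v::real_inner set \<Rightarrow> ('v \<Rightarrow> real) \<Rightarrow> 'v \<Rightarrow> 'v set" where
  "subdiff S F x = {g. \<forall>y\<in>S. F x + g \<bullet> (y - x) \<le> F y}"

definition strongly_convex_wrt ::
    "'v::real_inner set \<Rightarrow> ('v \<Rightarrow> real) \<Rightarrow> real \<Rightarrow> ('v \<Rightarrow> real) \<Rightarrow> bool" where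
  "strongly_convex_wrt S N \<mu> F \<longleftrightarrow>
     (\<forall>x\<in>S. \<forall>y\<in>S. \<forall>g\<in>subdiff S F y. F x \<ge> F y + g \<bullet> (x - y) + \<mu> / 2 * (N (x - y))\<^sup>2)"

(* w is continuously differentiable on the subspace E with gradient dw.  Requiring dw x to lie
   in E makes the gradient unique on E. *)
definition C1_with_gradient ::
    "'v::real_inner set \<Rightarrow> ('v \<Rightarrow> real) \<Rightarrow> ('v \<Rightarrow> 'v) \<Rightarrow> bool" where
  "C1_with_gradient E w dw \<longleftrightarrow>
     (\<forall>x\<in>E. dw x \<in> E \<and> (w has_derivative (\<lambda>h. dw x \<bullet> h)) (at x within E)) \<and>
     continuous_on E dw"

(* The base point is the first argument. *)
definition bregman ::
    "('v::real_inner \<Rightarrow> real) \<Rightarrow> ('v \<Rightarrow> 'v) \<Rightarrow> 'v \<Rightarrow> 'v \<Rightarrow> real" where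
  "bregman w dw x y = w y - w x - dw x \<bullet> (y - x)"

(* For closed convex nonempty S and a strongly convex C1 function w the minimizer exists and is
   unique, so the choice made by arg_min is immaterial. *)
definition prox ::
    "('v::real_inner \<Rightarrow> real) \<Rightarrow> ('v \<Rightarrow> 'v) \<Rightarrow> 'v set \<Rightarrow> 'v \<Rightarrow> 'v \<Rightarrow> 'v" where
  "prox w dw S x v = arg_min (\<lambda>z. v \<bullet> z + bregman w dw x z) (\<lambda>z. z \<in> S)"

definition error_fun ::
    "('n \<Rightarrow> 'l::finite) \<Rightarrow> ('l \<Rightarrow> real) \<Rightarrow> ('l \<Rightarrow> real ^ 'n \<Rightarrow> real) \<Rightarrow>
     ('l \<Rightarrow> real ^ 'n \<Rightarrow> real ^ 'n) \<Rightarrow> real ^ 'n \<Rightarrow> real ^ 'n \<Rightarrow> real" where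
  "error_fun b p w dw x z =
     (\<Sum>i\<in>UNIV. inverse (p i) * bregman (w i) (dw i) (block b i x) (block b i z))"

abbreviation sigma_index :: "'w measure \<Rightarrow> ('w \<Rightarrow> 'l) \<Rightarrow> 'w measure" where
  "sigma_index M J \<equiv> vimage_algebra (space M) J (count_space UNIV)"

abbreviation sigma_vec :: "'w measure \<Rightarrow> ('w \<Rightarrow> 'v::topological_space) \<Rightarrow> 'w measure" where
  "sigma_vec M X \<equiv> vimage_algebra (space M) X borel"

(* The sigma-algebra generated by I 0, X 0, ..., I (t-1), X (t-1); trivial for t = 0. *)
definition past ::
    "'w measure \<Rightarrow> (nat \<Rightarrow> 'w \<Rightarrow> 'l) \<Rightarrow> (nat \<Rightarrow> 'w \<Rightarrow> 'v::topological_space) \<Rightarrow> nat \<Rightarrow> 'w measure" where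
  "past M I X t =
     sigma (space M) (\<Union>s<t. sets (sigma_index M (I s)) \<union> sets (sigma_vec M (X s)))"

end

theory Submission
  imports Defs
begin

text \<open>
  The variational inequality for the prox mapping, the three-point identity for Bregman divergences
  and Young's inequality bound the divergence after a step in block \<open>i\<close> by
  \<open>D\<^sub>i + \<eta> \<langle>g\<^sub>i, \<beta>* - \<beta>\<rangle> + \<eta>\<^sup>2 \<parallel>g\<^sub>i\<parallel>\<^sup>2 / (2 \<mu>\<^sub>i)\<close>.  Averaging over \<open>i\<close> cancels the weights
  \<open>1 / p\<^sub>i\<close> of the error function, and strong convexity, used at both \<open>\<beta>\<close> and the minimizer, gives
  \<open>\<langle>g, \<beta> - \<beta>*\<rangle> \<ge> \<mu>\<^sub>F \<parallel>\<beta> - \<beta>*\<parallel>\<^sup>2\<close>.  All conditional expectations are taken of nonnegative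
  functions, so that integrability of the error along the iterates is never needed: by independence
  they reduce to integrals over the fresh sample with the current iterate frozen, and those are
  estimated for each fixed iterate.
\<close>

section \<open>Norms on a subspace of a Euclidean space and their duals\<close>

lemma is_norm_onD:
  assumes "is_norm_on E N" "x \<in> E"
  shows norm_on_nonneg: "0 \<le> N x"
    and norm_on_eq_0: "N x = 0 \<longleftrightarrow> x = 0"
    and norm_on_scale: "N (c *\<^sub>R x) = \<bar>c\<bar> * N x"
    and norm_on_triangle: "y \<in> E \<Longrightarrow> N (x + y) \<le> N x + N y"
  using assms unfolding is_norm_on_def by blast+

lemma norm_on_pos: "is_norm_on E N \<Longrightarrow> x \<in> E \<Longrightarrow> x \<noteq> 0 \<Longrightarrow> 0 < N x"
  using norm_on_nonneg[of E N x] norm_on_eq_0[of E N x] by simp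

lemma norm_on_sum_le:
  assumes "is_norm_on E N" "subspace E" "finite A" "\<And>a. a \<in> A \<Longrightarrow> f a \<in> E"
  shows "N (sum f A) \<le> (\<Sum>a\<in>A. N (f a))"
  using assms(3,4)
proof (induction A rule: finite_induct)
  case empty
  have "N 0 = 0"
    using norm_on_eq_0[OF assms(1) subspace_0[OF assms(2)]] by simp
  then show ?case by simp
next
  case (insert a A)
  have "N (f a + sum f A) \<le> N (f a) + N (sum f A)"
    using insert.prems subspace_sum[OF assms(2), of A f] by (intro norm_on_triangle[OF assms(1)]) auto
  then show ?case using insert by auto
qed

lemma norm_on_minus_commute:
  assumes "is_norm_on E N" "subspace E" "x \<in> E" "y \<in> E"
  shows "N (x - y) = N (y - x)"
proof -
  have "N ((-1) *\<^sub>R (y - x)) = \<bar>-1\<bar> * N (y - x)"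
    using subspace_diff[OF assms(2,4,3)] by (rule norm_on_scale[OF assms(1)])
  then show ?thesis by simp
qed

text \<open>Expanding in an orthonormal basis \<open>A\<close> of \<open>E\<close>, the triangle
  inequality and Cauchy-Schwarz give the constant \<open>\<Sum>a\<in>A. N a\<close>. This is one
  half of the equivalence with the Euclidean norm.\<close>

lemma norm_on_upper:
  fixes E :: "'v::euclidean_space set"
  assumes "is_norm_on E N" "subspace E"
  obtains K where "\<And>x. x \<in> E \<Longrightarrow> N x \<le> K * norm x"
proof -
  obtain A where A: "A \<subseteq> E" "pairwise orthogonal A" "\<And>x. x \<in> A \<Longrightarrow> norm x = 1"
    "independent A" "span A = E"
    using orthonormal_basis_subspace[OF assms(2)] by metis
  have fin: "finite A" using A(4) independent_imp_finite by blast
  have "N x \<le> (\<Sum>a\<in>A. N a) * norm x" if "x \<in> E" for x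
  proof -
    have "x = (\<Sum>a\<in>A. (x \<bullet> a) *\<^sub>R a)"
      using orthonormal_basis_expand[OF A(2,3) _ fin, of x] that A(5) by simp
    then have "N x = N (\<Sum>a\<in>A. (x \<bullet> a) *\<^sub>R a)" by (rule arg_cong)
    also have "\<dots> \<le> (\<Sum>a\<in>A. N ((x \<bullet> a) *\<^sub>R a))"
      using A(1) by (intro norm_on_sum_le[OF assms fin] subspace_scale[OF assms(2)]) auto
    also have "\<dots> \<le> (\<Sum>a\<in>A. N a * norm x)"
    proof (rule sum_mono)
      fix a assume a: "a \<in> A"
      then have "N ((x \<bullet> a) *\<^sub>R a) = \<bar>x \<bullet> a\<bar> * N a" "0 \<le> N a"
        using A(1) norm_on_scale[OF assms(1)] norm_on_nonneg[OF assms(1)] by auto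
      moreover have "\<bar>x \<bullet> a\<bar> \<le> norm x"
        using Cauchy_Schwarz_ineq2[of x a] A(3)[OF a] by simp
      ultimately show "N ((x \<bullet> a) *\<^sub>R a) \<le> N a * norm x"
        by (simp add: mult.commute mult_left_mono)
    qed
    finally show ?thesis by (simp add: sum_distrib_right)
  qed
  then show ?thesis using that by blast
qed

text \<open>The other half: \<open>N\<close> is Lipschitz by the upper bound, hence attains a
  positive minimum on the compact Euclidean unit sphere of \<open>E\<close>, and homogeneity carries
  this minimum to all of \<open>E\<close>.\<close>

lemma norm_on_lower:
  fixes E :: "'v::euclidean_space set"
  assumes "is_norm_on E N" "subspace E"
  obtains c where "c > 0" "\<And>x. x \<in> E \<Longrightarrow> c * norm x \<le> N x"
proof -
  obtain K where K: "\<And>x. x \<in> E \<Longrightarrow> N x \<le> K * norm x"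
    using norm_on_upper[OF assms] by blast
  have diff: "\<bar>N x - N y\<bar> \<le> K * norm (x - y)" if "x \<in> E" "y \<in> E" for x y
  proof -
    have "N u \<le> N (u - v) + N v" if "u \<in> E" "v \<in> E" for u v
      using norm_on_triangle[OF assms(1) subspace_diff[OF assms(2) that] that(2)] by simp
    from this[OF that] this[OF that(2,1)] show ?thesis
      using K[OF subspace_diff[OF assms(2) that]] norm_on_minus_commute[OF assms that] by linarith
  qed
  have "continuous_on E N"
  proof (rule continuous_on_iff[THEN iffD2], intro ballI allI impI)
    fix x e :: real and u assume u: "u \<in> E" and e: "0 < e"
    show "\<exists>d>0. \<forall>y\<in>E. dist y u < d \<longrightarrow> dist (N y) (N u) < e"
    \<comment> \<open>The sign of \<open>K\<close> is unknown and \<open>K\<close> may be 0, so the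
      radius is built from \<open>\<bar>K\<bar> + 1\<close>.\<close>
    proof (intro exI[of _ "e / (\<bar>K\<bar> + 1)"] conjI ballI impI)
      show "0 < e / (\<bar>K\<bar> + 1)" using e by simp
      fix y assume y: "y \<in> E" "dist y u < e / (\<bar>K\<bar> + 1)"
      have "K * norm (y - u) \<le> (\<bar>K\<bar> + 1) * norm (y - u)"
        by (intro mult_right_mono) auto
      also have "\<dots> < e"
        using y(2) by (simp add: dist_norm field_simps)
      finally show "dist (N y) (N u) < e"
        using diff[OF y(1) u] by (simp add: dist_real_def)
    qed
  qed
  then have cont: "continuous_on (E \<inter> sphere 0 1) N"
    using continuous_on_subset by blast
  have comp: "compact (E \<inter> sphere 0 1)"
    using closed_subspace[OF assms(2)] compact_sphere by (simp add: closed_Int_compact)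
  obtain c where c: "c > 0" "\<And>x. x \<in> E \<inter> sphere 0 1 \<Longrightarrow> c \<le> N x"
  \<comment> \<open>The sphere is empty when \<open>E\<close> is trivial, as for a block label that
    no coordinate carries; then any positive constant serves.\<close>
  proof (cases "E \<inter> sphere 0 1 = {}")
    case True
    show ?thesis by (rule that[of 1]) (use True in auto)
  next
    case False
    obtain x where x: "x \<in> E \<inter> sphere 0 1" "\<And>y. y \<in> E \<inter> sphere 0 1 \<Longrightarrow> N x \<le> N y"
      using continuous_attains_inf[OF comp False cont] by blast
    then have "x \<noteq> 0" by auto
    then show ?thesis using that[of "N x"] x norm_on_pos[OF assms(1), of x] by auto
  qed
  have "c * norm x \<le> N x" if "x \<in> E" for x
  proof (cases "x = 0")
    case True
    then show ?thesis using norm_on_eq_0[OF assms(1) that] by simp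
  next
    case False
    let ?u = "inverse (norm x) *\<^sub>R x"
    have u: "?u \<in> E \<inter> sphere 0 1" using that subspace_scale[OF assms(2)] False by simp
    have "N ?u = inverse (norm x) * N x"
      using norm_on_scale[OF assms(1) that] by simp
    then have "c \<le> inverse (norm x) * N x" using c(2)[OF u] by simp
    then show ?thesis using False by (simp add: field_simps)
  qed
  then show ?thesis using that c(1) by blast
qed

text \<open>The generalized Cauchy-Schwarz inequality, from testing the supremum with
  \<open>z\<close> divided by \<open>N z\<close>. The lower norm bound makes the
  \<open>N\<close>-unit ball Euclidean bounded, so \<open>SUP\<close> is a genuine supremum and not
  a default value.\<close>

lemma dual_norm_upper:
  fixes E :: "'v::euclidean_space set"
  assumes "is_norm_on E N" "subspace E" "z \<in> E"
  shows "u \<bullet> z \<le> dual_norm E N u * N z"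
proof (cases "z = 0")
  case True
  then show ?thesis using norm_on_eq_0[OF assms(1,3)] by simp
next
  case False
  obtain c where c: "c > 0" "\<And>x. x \<in> E \<Longrightarrow> c * norm x \<le> N x"
    using norm_on_lower[OF assms(1,2)] by blast
  have N0: "N z > 0"
    using norm_on_pos[OF assms(1,3) False] .
  have "bdd_above ((\<lambda>v. u \<bullet> v) ` {v \<in> E. N v \<le> 1})"
  proof (rule bdd_aboveI2)
    fix v assume "v \<in> {v \<in> E. N v \<le> 1}"
    then have "norm v \<le> 1 / c" using c(1) c(2)[of v] by (auto simp: field_simps)
    then show "u \<bullet> v \<le> norm u * (1 / c)"
      using norm_cauchy_schwarz[of u v] mult_left_mono[of "norm v" "1 / c" "norm u"] by simp
  qed
  moreover have "inverse (N z) *\<^sub>R z \<in> {v \<in> E. N v \<le> 1}"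
  proof -
    have "N (inverse (N z) *\<^sub>R z) = \<bar>inverse (N z)\<bar> * N z"
      by (rule norm_on_scale[OF assms(1,3)])
    then show ?thesis using assms(2,3) N0 by (simp add: subspace_scale)
  qed
  ultimately have "u \<bullet> (inverse (N z) *\<^sub>R z) \<le> dual_norm E N u"
    unfolding dual_norm_def by (intro cSUP_upper)
  then show ?thesis using N0 by (simp add: field_simps)
qed

section \<open>A single mirror map: its Bregman divergence and its prox mapping\<close>

locale mirror_map =
  fixes E S :: "'v::euclidean_space set" and N w :: "'v \<Rightarrow> real" and dw :: "'v \<Rightarrow> 'v" and \<mu> L :: real
  assumes E: "subspace E"
    and S: "S \<subseteq> E" "S \<noteq> {}" "closed S" "convex S"
    and N: "is_norm_on E N"
    and C1: "C1_with_gradient E w dw"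
    and \<mu>: "\<mu> > 0"
    and lower: "\<And>x y. x \<in> S \<Longrightarrow> y \<in> S \<Longrightarrow> \<mu> / 2 * (N (y - x))\<^sup>2 \<le> bregman w dw x y"
    and upper: "\<And>x y. x \<in> S \<Longrightarrow> y \<in> S \<Longrightarrow> bregman w dw x y \<le> L / 2 * (N (y - x))\<^sup>2"
begin

lemma bregman_nonneg: "x \<in> S \<Longrightarrow> y \<in> S \<Longrightarrow> 0 \<le> bregman w dw x y"
  using lower[of x y] \<mu> by (smt (verit) divide_nonneg_nonneg mult_nonneg_nonneg zero_le_power2)

lemma continuous_dw: "continuous_on S dw"
  using C1 S(1) continuous_on_subset unfolding C1_with_gradient_def by blast

lemma continuous_w: "continuous_on S w"
proof -
  have "continuous_on E w"
    using C1 has_derivative_continuous unfolding C1_with_gradient_def continuous_on_eq_continuous_within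
    by blast
  then show ?thesis using S(1) continuous_on_subset by blast
qed

lemma continuous_on_bregman: "continuous_on S (\<lambda>x. bregman w dw x z)"
  unfolding bregman_def by (intro continuous_intros continuous_w continuous_dw)

text \<open>Restates strong convexity in the Euclidean norm, in which the compactness argument for
  the prox mapping and its Lipschitz estimate are carried out.\<close>

lemma bregman_quadratic_growth:
  obtains c where "c > 0" "\<And>x y. x \<in> S \<Longrightarrow> y \<in> S \<Longrightarrow> c * (norm (y - x))\<^sup>2 \<le> bregman w dw x y"
proof -
  obtain c where c: "c > 0" "\<And>x. x \<in> E \<Longrightarrow> c * norm x \<le> N x"
    using norm_on_lower[OF N E] by blast
  have "\<mu> / 2 * c\<^sup>2 * (norm (y - x))\<^sup>2 \<le> bregman w dw x y" if "x \<in> S" "y \<in> S" for x y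
  proof -
    have "y - x \<in> E" using that S(1) subspace_diff[OF E] by blast
    then have "(c * norm (y - x))\<^sup>2 \<le> (N (y - x))\<^sup>2" using c by (intro power_mono) auto
    then have "\<mu> / 2 * (c * norm (y - x))\<^sup>2 \<le> \<mu> / 2 * (N (y - x))\<^sup>2"
      using \<mu> by (intro mult_left_mono) auto
    then show ?thesis using lower[OF that] by (simp add: power_mult_distrib mult.assoc)
  qed
  then show ?thesis using that[of "\<mu> / 2 * c\<^sup>2"] \<mu> c(1) by simp
qed

text \<open>On the compact part of \<open>S\<close> within distance \<open>norm v / c\<close> of
  \<open>x\<close> a minimizer exists by continuity. Farther away the quadratic growth of the
  divergence outweighs the linear term, so no value falls below the one at \<open>x\<close>.
  Existence is what makes the choice inside \<open>prox\<close> meaningful.\<close>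

lemma is_arg_min_prox:
  assumes x: "x \<in> S"
  shows "is_arg_min (\<lambda>z. v \<bullet> z + bregman w dw x z) (\<lambda>z. z \<in> S) (prox w dw S x v)"
proof -
  let ?h = "\<lambda>z. v \<bullet> z + bregman w dw x z"
  obtain c where c: "c > 0" "\<And>x y. x \<in> S \<Longrightarrow> y \<in> S \<Longrightarrow> c * (norm (y - x))\<^sup>2 \<le> bregman w dw x y"
    using bregman_quadratic_growth by blast
  have cont: "continuous_on (S \<inter> cball x (norm v / c)) ?h"
    unfolding bregman_def
    by (intro continuous_intros continuous_on_subset[OF continuous_w]) auto
  have comp: "compact (S \<inter> cball x (norm v / c))" using S(3) by (simp add: closed_Int_compact)
  have ne: "S \<inter> cball x (norm v / c) \<noteq> {}" using x c(1) by auto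
  obtain z where z: "z \<in> S \<inter> cball x (norm v / c)"
    "\<And>y. y \<in> S \<inter> cball x (norm v / c) \<Longrightarrow> ?h z \<le> ?h y"
    using continuous_attains_inf[OF comp ne cont] by blast
  have "?h z \<le> ?h y" if y: "y \<in> S" for y
  proof (cases "norm (y - x) \<le> norm v / c")
    case True
    then show ?thesis using z(2)[of y] y by (simp add: dist_norm norm_minus_commute)
  next
    case False
    have "?h z \<le> ?h x" using z(2) x c(1) by simp
    also have "\<dots> = v \<bullet> x" by (simp add: bregman_def)
    also have "v \<bullet> x \<le> v \<bullet> y + norm v * norm (y - x)"
      using norm_cauchy_schwarz[of "-v" "y - x"] by (simp add: inner_diff_right)
    also have "norm v * norm (y - x) \<le> c * norm (y - x) * norm (y - x)"
      using False c(1) by (intro mult_right_mono) (auto simp: field_simps)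
    also have "v \<bullet> y + \<dots> \<le> ?h y"
      using c(2)[OF x y] by (simp add: power2_eq_square mult.assoc)
    finally show ?thesis by simp
  qed
  then have "is_arg_min ?h (\<lambda>z. z \<in> S) z"
    using z(1) unfolding is_arg_min_linorder by blast
  then show ?thesis unfolding prox_def arg_min_def by (rule someI)
qed

lemma prox_in: "x \<in> S \<Longrightarrow> prox w dw S x v \<in> S"
  using is_arg_min_prox unfolding is_arg_min_def by blast

text \<open>First-order optimality, obtained by moving from the minimizer \<open>z\<close> a
  fraction \<open>s\<close> towards \<open>u\<close>. The upper Bregman bound makes the remainder
  quadratic in \<open>s\<close>; dividing by \<open>s\<close> and letting it tend to 0 from the
  right leaves the linear term.\<close>

lemma prox_variational:
  fixes v :: 'v
  assumes x: "x \<in> S" and u: "u \<in> S"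
  defines "z \<equiv> prox w dw S x v"
  shows "0 \<le> (v + dw z - dw x) \<bullet> (u - z)"
proof -
  have z: "z \<in> S" using prox_in[OF x] z_def by simp
  define A where "A = (v + dw z - dw x) \<bullet> (u - z)"
  define K where "K = L / 2 * (N (u - z))\<^sup>2"
  have "0 \<le> A + s * K" if s: "0 < s" "s \<le> 1" for s
  proof -
    define y where "y = z + s *\<^sub>R (u - z)"
    have y: "y \<in> S"
      using convexD_alt[OF S(4) z u, of s] s by (simp add: y_def algebra_simps)
    have "v \<bullet> z + bregman w dw x z \<le> v \<bullet> y + bregman w dw x y"
      using is_arg_min_prox[OF x, of v] y unfolding is_arg_min_linorder z_def by blast
    \<comment> \<open>The right-hand side is exactly the increase of the objective from
      \<open>z\<close> to \<open>y\<close>, with the divergence based at \<open>z\<close> as its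
      second-order remainder.\<close>
    then have "0 \<le> (v + dw z - dw x) \<bullet> (y - z) + bregman w dw z y"
      by (simp add: bregman_def algebra_simps inner_diff_right inner_add_left inner_diff_left)
    also have "bregman w dw z y \<le> L / 2 * (N (y - z))\<^sup>2" using upper z y by blast
    also have "N (y - z) = s * N (u - z)"
    proof -
      have "u - z \<in> E" using u z S(1) subspace_diff[OF E] by blast
      then have "N (s *\<^sub>R (u - z)) = \<bar>s\<bar> * N (u - z)" by (rule norm_on_scale[OF N])
      then show ?thesis using s by (simp add: y_def)
    qed
    finally have "0 \<le> s * (A + s * K)"
      by (simp add: A_def K_def y_def algebra_simps power2_eq_square)
    then show ?thesis using s by (simp add: zero_le_mult_iff)
  qed
  note ev = this
  have "((\<lambda>s. A + s * K) \<longlongrightarrow> A + 0 * K) (at_right 0)"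
    by (intro tendsto_intros)
  moreover have "\<forall>\<^sub>F s in at_right 0. 0 \<le> A + s * K"
    using ev unfolding eventually_at_right_field by (intro exI[of _ 1]) auto
  ultimately have "0 \<le> A + 0 * K"
    by (rule tendsto_lowerbound) simp
  then show ?thesis by (simp add: A_def)
qed

lemma bregman_prox_le:
  assumes x: "x \<in> S" and z: "z \<in> S" and \<eta>: "0 \<le> \<eta>"
  shows "bregman w dw (prox w dw S x (\<eta> *\<^sub>R u)) z
           \<le> bregman w dw x z + \<eta> * (u \<bullet> (z - x)) + \<eta>\<^sup>2 * ((dual_norm E N u)\<^sup>2 / (2 * \<mu>))"
proof -
  define y where "y = prox w dw S x (\<eta> *\<^sub>R u)"
  have y: "y \<in> S" using prox_in[OF x] y_def by simp
  have E': "x - y \<in> E" using x y S(1) subspace_diff[OF E] by blast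
  define d where "d = dual_norm E N u"
  have "0 \<le> (\<eta> *\<^sub>R u + dw y - dw x) \<bullet> (z - y)"
    unfolding y_def by (rule prox_variational[OF x z])
  \<comment> \<open>The three-point identity turns the gradient difference into three divergences,
    and \<open>z - y\<close> is split as \<open>(z - x) + (x - y)\<close>.\<close>
  then have "bregman w dw y z \<le> bregman w dw x z + \<eta> * (u \<bullet> (z - x))
      + (\<eta> * (u \<bullet> (x - y)) - bregman w dw x y)"
    by (simp add: bregman_def algebra_simps inner_diff_right inner_add_left inner_diff_left)
  also have "\<eta> * (u \<bullet> (x - y)) \<le> \<eta> * (d * N (x - y))"
    using dual_norm_upper[OF N E E', of u] \<eta> unfolding d_def by (rule mult_left_mono)
  also have "\<dots> \<le> \<eta>\<^sup>2 * (d\<^sup>2 / (2 * \<mu>)) + \<mu> / 2 * (N (x - y))\<^sup>2"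
  proof -
    \<comment> \<open>Young's inequality as a completed square, weighted so that the quadratic term
      is exactly the one absorbed by the divergence from \<open>x\<close> to
      \<open>y\<close>.\<close>
    have "0 \<le> (\<eta> * d - \<mu> * N (x - y))\<^sup>2 / (2 * \<mu>)" using \<mu> by simp
    also have "\<dots> = \<eta>\<^sup>2 * (d\<^sup>2 / (2 * \<mu>)) + \<mu> / 2 * (N (x - y))\<^sup>2 - \<eta> * (d * N (x - y))"
      using \<mu> by (simp add: field_simps power2_eq_square)
    finally show ?thesis by simp
  qed
  also have "\<mu> / 2 * (N (x - y))\<^sup>2 \<le> bregman w dw x y"
    using lower[OF x y] norm_on_minus_commute[OF N E] x y S(1) by (metis subsetD)
  finally show ?thesis by (simp add: y_def d_def)
qed

text \<open>Serves the measurability of the iterates. The prox point is a Lipschitz function of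
  \<open>v - dw x\<close> with constant \<open>1 / c\<close>: adding the variational inequalities at
  two prox points bounds the monotonicity of \<open>dw\<close> by the difference of these
  vectors.\<close>

lemma continuous_on_prox: "continuous_on (S \<times> UNIV) (\<lambda>(x, v). prox w dw S x v)"
proof -
  obtain c where c: "c > 0" "\<And>x y. x \<in> S \<Longrightarrow> y \<in> S \<Longrightarrow> c * (norm (y - x))\<^sup>2 \<le> bregman w dw x y"
    using bregman_quadratic_growth by blast
  define \<phi> where "\<phi> = (\<lambda>(x, v). v - dw x)"
  have \<phi>: "continuous_on (S \<times> UNIV) \<phi>"
    unfolding \<phi>_def split_beta
    by (intro continuous_intros continuous_on_compose2[OF continuous_dw]) auto
  have lip: "c * norm (prox w dw S x v - prox w dw S x' v') \<le> norm (\<phi> (x, v) - \<phi> (x', v'))"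
    if x: "x \<in> S" "x' \<in> S" for x x' v v'
  proof -
    define z z' where "z = prox w dw S x v" and "z' = prox w dw S x' v'"
    have z: "z \<in> S" "z' \<in> S" using prox_in x z_def z'_def by auto
    have "0 \<le> (v + dw z - dw x) \<bullet> (z' - z)" "0 \<le> (v' + dw z' - dw x') \<bullet> (z - z')"
      using prox_variational[OF x(1) z(2)] prox_variational[OF x(2) z(1)] z_def z'_def by auto
    \<comment> \<open>The symmetrized divergence is the monotonicity pairing of \<open>dw\<close>.
      Its first summand supplies the growth constant \<open>c\<close>, and the second is only
      bounded below by 0.\<close>
    moreover have "bregman w dw z z' + bregman w dw z' z = (dw z' - dw z) \<bullet> (z' - z)"
      by (simp add: bregman_def algebra_simps inner_diff_right inner_diff_left)
    ultimately have "bregman w dw z z' + bregman w dw z' z \<le> (\<phi> (x, v) - \<phi> (x', v')) \<bullet> (z' - z)"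
      by (simp add: \<phi>_def algebra_simps inner_diff_right inner_add_left inner_diff_left)
    also have "\<dots> \<le> norm (\<phi> (x, v) - \<phi> (x', v')) * norm (z - z')"
      by (metis norm_cauchy_schwarz norm_minus_commute)
    finally have "c * norm (z - z') * norm (z - z') \<le> norm (\<phi> (x, v) - \<phi> (x', v')) * norm (z - z')"
      using c(2)[OF z] bregman_nonneg[OF z(2,1)]
      by (simp add: power2_eq_square mult.assoc norm_minus_commute)
    then show ?thesis
      by (cases "z = z'") (auto simp: z_def z'_def)
  qed
  show ?thesis
  proof (rule continuous_on_iff[THEN iffD2], intro ballI allI impI)
    fix q :: "'v \<times> 'v" and e :: real assume q: "q \<in> S \<times> UNIV" and e: "0 < e"
    have "0 < c * e" using c(1) e by simp
    from \<phi>[unfolded continuous_on_iff, rule_format, OF q this] obtain d where d: "d > 0"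
      "\<And>q'. q' \<in> S \<times> UNIV \<Longrightarrow> dist q' q < d \<Longrightarrow> dist (\<phi> q') (\<phi> q) < c * e"
      by blast
    show "\<exists>d>0. \<forall>q'\<in>S \<times> UNIV. dist q' q < d \<longrightarrow>
      dist (case q' of (x, v) \<Rightarrow> prox w dw S x v) (case q of (x, v) \<Rightarrow> prox w dw S x v) < e"
    proof (intro exI[of _ d] conjI ballI impI d(1))
      fix q' :: "'v \<times> 'v" assume q': "q' \<in> S \<times> UNIV" "dist q' q < d"
      have "c * dist (case q' of (x, v) \<Rightarrow> prox w dw S x v) (case q of (x, v) \<Rightarrow> prox w dw S x v)
          \<le> dist (\<phi> q') (\<phi> q)"
        using lip[of "fst q'" "fst q" "snd q'" "snd q"] q q'(1) by (auto simp: dist_norm)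
      also have "\<dots> < c * e" using d(2)[OF q'] .
      finally show "dist (case q' of (x, v) \<Rightarrow> prox w dw S x v) (case q of (x, v) \<Rightarrow> prox w dw S x v) < e"
        using c(1) by simp
    qed
  qed
qed

end

section \<open>Conditional expectations under independence\<close>

text \<open>Independence makes the joint law of \<open>Y\<close> and the identity map into
  \<open>P\<close> a product measure, and Tonelli's theorem then verifies the defining property of
  the conditional expectation. Using the identity as second variable lets \<open>\<Phi>\<close>
  depend on the outcome in any \<open>P\<close>-measurable way.\<close>

lemma (in prob_space) nn_cond_exp_freeze:
  assumes sub: "subalgebra M P" and Y: "Y \<in> measurable M T"
    and ind: "indep_set (sets (vimage_algebra (space M) Y T)) (sets P)"
    and \<Phi>: "(\<lambda>(w, y). \<Phi> w y) \<in> borel_measurable (P \<Otimes>\<^sub>M T)"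
  shows "AE w in M. nn_cond_exp M P (\<lambda>w. \<Phi> w (Y w)) w = (\<integral>\<^sup>+ y. \<Phi> w y \<partial>distr M T Y)"
proof -
  interpret finite_measure_subalgebra M P
    by unfold_locales (rule sub)
  have id: "(\<lambda>w. w) \<in> measurable M P"
    by (rule measurable_from_subalg[OF sub measurable_ident_sets[OF refl]])
  interpret Y: prob_space "distr M T Y" by (rule prob_space_distr[OF Y])
  interpret X: prob_space "distr M P (\<lambda>w. w)" by (rule prob_space_distr[OF id])
  have joint: "distr M T Y \<Otimes>\<^sub>M distr M P (\<lambda>w. w) = distr M (T \<Otimes>\<^sub>M P) (\<lambda>w. (Y w, w))"
  proof (rule pair_measure_eqI)
    show "sigma_finite_measure (distr M T Y)" "sigma_finite_measure (distr M P (\<lambda>w. w))"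
      by unfold_locales
    show "sets (distr M T Y \<Otimes>\<^sub>M distr M P (\<lambda>w. w)) = sets (distr M (T \<Otimes>\<^sub>M P) (\<lambda>w. (Y w, w)))"
      by (simp cong: sets_pair_measure_cong)
    fix A B assume "A \<in> sets (distr M T Y)" "B \<in> sets (distr M P (\<lambda>w. w))"
    then have A: "A \<in> sets T" and B: "B \<in> sets P" by auto
    have BM: "B \<in> sets M" "B \<subseteq> space M"
      using B sub sets.sets_into_space[of B P] unfolding subalgebra_def by auto
    have "Y -` A \<inter> space M \<in> sets (vimage_algebra (space M) Y T)"
      by (rule in_vimage_algebra[OF A])
    then have "prob ((Y -` A \<inter> space M) \<inter> B) = prob (Y -` A \<inter> space M) * prob B"
      using ind B unfolding indep_sets2_eq by blast
    then have "emeasure M ((Y -` A \<inter> space M) \<inter> B) = emeasure M (Y -` A \<inter> space M) * emeasure M B"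
      by (simp add: emeasure_eq_measure ennreal_mult)
    moreover have "(\<lambda>w. (Y w, w)) -` (A \<times> B) \<inter> space M = (Y -` A \<inter> space M) \<inter> B"
      "(\<lambda>w. w) -` B \<inter> space M = B"
      using BM by auto
    ultimately show "emeasure (distr M T Y) A * emeasure (distr M P (\<lambda>w. w)) B
        = emeasure (distr M (T \<Otimes>\<^sub>M P) (\<lambda>w. (Y w, w))) (A \<times> B)"
      using A B Y id measurable_Pair[OF Y id] by (simp add: emeasure_distr)
  qed
  have meas: "(\<lambda>w. \<Phi> w (Y w)) \<in> borel_measurable M"
    using measurable_compose[OF measurable_Pair[OF id Y] \<Phi>] by simp
  have meas': "(\<lambda>w. \<integral>\<^sup>+ y. \<Phi> w y \<partial>distr M T Y) \<in> borel_measurable P"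
    using \<Phi> by (intro Y.borel_measurable_nn_integral) simp
  have "AE w in M. (\<integral>\<^sup>+ y. \<Phi> w y \<partial>distr M T Y) = nn_cond_exp M P (\<lambda>w. \<Phi> w (Y w)) w"
  proof (rule nn_cond_exp_charact[OF _ meas meas'])
    fix A assume A: "A \<in> sets P"
    have [measurable]: "(\<lambda>w. w) \<in> measurable M P" "Y \<in> measurable M T" "A \<in> sets P"
      using id Y A by auto
    have [measurable]: "(\<lambda>q. \<Phi> (snd q) (fst q)) \<in> borel_measurable (T \<Otimes>\<^sub>M P)"
      using measurable_compose[OF measurable_pair_swap' \<Phi>] by (simp add: split_beta)
    \<comment> \<open>The test set \<open>A\<close> lies in \<open>P\<close>, so its indicator
      depends on the second coordinate alone and leaves the inner integral.\<close>
    let ?f = "\<lambda>q. \<Phi> (snd q) (fst q) * indicator A (snd q)"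
    have f: "?f \<in> borel_measurable (T \<Otimes>\<^sub>M P)" by measurable
    have "(\<integral>\<^sup>+w\<in>A. \<Phi> w (Y w) \<partial>M) = (\<integral>\<^sup>+q. ?f q \<partial>distr M (T \<Otimes>\<^sub>M P) (\<lambda>w. (Y w, w)))"
      using f by (subst nn_integral_distr) auto
    also have "\<dots> = (\<integral>\<^sup>+q. ?f q \<partial>(distr M T Y \<Otimes>\<^sub>M distr M P (\<lambda>w. w)))"
      by (simp add: joint)
    also have "\<dots> = (\<integral>\<^sup>+w. \<integral>\<^sup>+y. ?f (y, w) \<partial>distr M T Y \<partial>distr M P (\<lambda>w. w))"
    proof -
      interpret pair_sigma_finite "distr M T Y" "distr M P (\<lambda>w. w)" ..
      show ?thesis
        using f by (subst nn_integral_snd[symmetric]) (auto cong: measurable_cong_sets)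
    qed
    also have "\<dots> = (\<integral>\<^sup>+w. (\<integral>\<^sup>+y. \<Phi> w y \<partial>distr M T Y) * indicator A w \<partial>distr M P (\<lambda>w. w))"
    proof (rule nn_integral_cong)
      fix w assume "w \<in> space (distr M P (\<lambda>w. w))"
      then have "(\<lambda>y. \<Phi> w y) \<in> borel_measurable T"
        using measurable_Pair2[OF \<Phi>, of w] by simp
      then show "(\<integral>\<^sup>+y. ?f (y, w) \<partial>distr M T Y) = (\<integral>\<^sup>+y. \<Phi> w y \<partial>distr M T Y) * indicator A w"
        by (simp add: nn_integral_multc)
    qed
    also have "\<dots> = (\<integral>\<^sup>+w\<in>A. (\<integral>\<^sup>+ y. \<Phi> w y \<partial>distr M T Y) \<partial>M)"
      using meas' by (subst nn_integral_distr) auto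
    finally show "(\<integral>\<^sup>+w\<in>A. \<Phi> w (Y w) \<partial>M) = (\<integral>\<^sup>+w\<in>A. (\<integral>\<^sup>+ y. \<Phi> w y \<partial>distr M T Y) \<partial>M)" .
  qed
  then show ?thesis by (simp add: eq_commute)
qed

lemma (in prob_space) nn_integral_finite_valued:
  fixes I :: "'a \<Rightarrow> 'l::finite"
  assumes I: "I \<in> measurable M (count_space UNIV)"
  shows "(\<integral>\<^sup>+ i. f i \<partial>distr M (count_space UNIV) I)
           = (\<Sum>i\<in>UNIV. ennreal (prob {w \<in> space M. I w = i}) * f i)"
proof -
  have [measurable]: "I \<in> measurable M (count_space UNIV)" by (rule I)
  have "(\<integral>\<^sup>+ i. f i \<partial>distr M (count_space UNIV) I) = (\<integral>\<^sup>+ w. f (I w) \<partial>M)"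
    by (subst nn_integral_distr) auto
  also have "\<dots> = (\<integral>\<^sup>+ w. (\<Sum>i\<in>UNIV. f i * indicator {w \<in> space M. I w = i} w) \<partial>M)"
  proof (rule nn_integral_cong)
    fix w assume "w \<in> space M"
    then have "(\<Sum>i\<in>UNIV. f i * indicator {w \<in> space M. I w = i} w)
        = (\<Sum>i\<in>UNIV. if I w = i then f i else 0)"
      by (intro sum.cong) (auto simp: indicator_def)
    then show "f (I w) = (\<Sum>i\<in>UNIV. f i * indicator {w \<in> space M. I w = i} w)"
      by (simp add: sum.delta)
  qed
  also have "\<dots> = (\<Sum>i\<in>UNIV. f i * emeasure M {w \<in> space M. I w = i})"
    by (subst nn_integral_sum) (auto simp: nn_integral_cmult)
  finally show ?thesis by (simp add: emeasure_eq_measure mult.commute)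
qed

section \<open>The filtration generated by the indices and samples\<close>

lemma space_past: "space (past M I X t) = space M"
  unfolding past_def by (rule space_measure_of_conv)

lemma sets_past:
  "sets (past M I X t)
     = sigma_sets (space M) (\<Union>s<t. sets (sigma_index M (I s)) \<union> sets (sigma_vec M (X s)))"
  unfolding past_def
  by (intro sets_measure_of) (auto dest: sets.sets_into_space[THEN subsetD])

lemma sets_vimage_algebra_subset:
  "f \<in> measurable M T \<Longrightarrow> sets (vimage_algebra (space M) f T) \<subseteq> sets M"
  using measurable_sets[of f M T] measurable_space[of f M T]
  by (subst sets_vimage_algebra2) auto

text \<open>\<open>past\<close> is generated by preimage sigma-algebras, so an inclusion between
  sigma-algebras is the form in which measurability of an index or a sample is available.\<close>

lemma measurable_if_sets_vimage:
  assumes "f \<in> space P \<rightarrow> space T" "sets (vimage_algebra (space P) f T) \<subseteq> sets P"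
  shows "f \<in> measurable P T"
  using assms in_vimage_algebra[of _ T f "space P"] unfolding measurable_def by blast

lemma subalgebra_past:
  assumes "\<And>s. I s \<in> measurable M (count_space UNIV)" "\<And>s. X s \<in> borel_measurable M"
  shows "subalgebra M (past M I X t)"
  unfolding subalgebra_def space_past sets_past
  using sets_vimage_algebra_subset[OF assms(1)] sets_vimage_algebra_subset[OF assms(2)]
  by (auto intro!: sets.sigma_sets_subset)

lemma subalgebra_past_Suc: "subalgebra (past M I X (Suc t)) (past M I X t)"
  unfolding subalgebra_def space_past sets_past
  by (intro conjI refl sigma_sets_mono' UN_mono) auto

lemma measurable_past_index: "I t \<in> measurable (past M I X (Suc t)) (count_space UNIV)"
  by (rule measurable_if_sets_vimage) (auto simp: space_past sets_past)

lemma measurable_past_vec: "X t \<in> borel_measurable (past M I X (Suc t))"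
  by (rule measurable_if_sets_vimage) (auto simp: space_past sets_past)

section \<open>Decomposition into coordinate blocks\<close>

lemma block_in_block_space: "block b i x \<in> block_space b i"
  by (simp add: block_def block_space_def)

lemma subspace_block_space: "subspace (block_space b i)"
  by (simp add: subspace_def block_space_def)

lemma linear_block: "linear (block b i)"
  by (rule linearI) (auto simp: block_def vec_eq_iff)

lemma borel_measurable_block[measurable]: "block b i \<in> borel_measurable borel"
  for b :: "'n::finite \<Rightarrow> 'l"
  by (intro borel_measurable_continuous_onI linear_continuous_on linear_conv_bounded_linear[THEN iffD1] linear_block)

lemma block_diff: "block b i (x - y) = block b i x - block b i y"
  by (rule linear_diff[OF linear_block])

lemma sum_block: "(\<Sum>i\<in>UNIV. block b i x) = x"
  for b :: "'n::finite \<Rightarrow> 'l::finite"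
  by (simp add: vec_eq_iff block_def if_distrib sum.delta cong: if_cong)

lemma sum_block_inner: "(\<Sum>i\<in>UNIV. block b i u \<bullet> block b i v) = u \<bullet> v"
  for b :: "'n::finite \<Rightarrow> 'l::finite"
proof -
  have "block b i u \<bullet> block b i v = block b i u \<bullet> v" for i
    by (auto simp: block_def inner_vec_def intro!: sum.cong)
  then show ?thesis by (simp add: inner_sum_left[symmetric] sum_block)
qed

section \<open>Strong convexity, the error function and one randomized step\<close>

text \<open>Subgradients are tested on \<open>S\<close> only, so constrained minimality of
  \<open>z\<close> says that 0 is a subgradient there. Strong convexity at \<open>z\<close> and at
  \<open>x\<close> each contributes \<open>\<mu> / 2\<close>; their sum gives the full
  \<open>\<mu>\<close>, which accounts for the factor 2 in the contraction rate.\<close>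

lemma strongly_convex_wrt_inner_ge:
  assumes F: "strongly_convex_wrt S N \<mu> F" and z: "is_arg_min F (\<lambda>x. x \<in> S) z"
    and x: "x \<in> S" and g: "g \<in> subdiff S F x" and sym: "N (x - z) = N (z - x)"
  shows "\<mu> * (N (z - x))\<^sup>2 \<le> g \<bullet> (x - z)"
proof -
  have zS: "z \<in> S" and "\<And>y. y \<in> S \<Longrightarrow> F z \<le> F y"
    using z unfolding is_arg_min_linorder by auto
  then have "0 \<in> subdiff S F z" by (simp add: subdiff_def)
  then have "F x \<ge> F z + 0 \<bullet> (x - z) + \<mu> / 2 * (N (x - z))\<^sup>2"
    using F x zS unfolding strongly_convex_wrt_def by blast
  moreover have "F z \<ge> F x + g \<bullet> (z - x) + \<mu> / 2 * (N (z - x))\<^sup>2"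
    using F g x zS unfolding strongly_convex_wrt_def by blast
  ultimately show ?thesis using sym by (simp add: inner_diff_right algebra_simps)
qed

locale block_mirror_maps =
  fixes b :: "'n::finite \<Rightarrow> 'l::finite"
    and B :: "'l \<Rightarrow> (real ^ 'n) set"
    and N \<omega> :: "'l \<Rightarrow> real ^ 'n \<Rightarrow> real"
    and d\<omega> :: "'l \<Rightarrow> real ^ 'n \<Rightarrow> real ^ 'n"
    and \<mu>\<omega> L\<omega> p :: "'l \<Rightarrow> real"
  assumes mirror_map: "\<And>i. mirror_map (block_space b i) (B i) (N i) (\<omega> i) (d\<omega> i) (\<mu>\<omega> i) (L\<omega> i)"
    and p: "\<And>i. p i > 0" "(\<Sum>i\<in>UNIV. p i) = 1"
begin

sublocale mm: mirror_map "block_space b i" "B i" "N i" "\<omega> i" "d\<omega> i" "\<mu>\<omega> i" "L\<omega> i" for i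
  by (rule mirror_map)

abbreviation "X \<equiv> block_prod b B"
abbreviation "err \<equiv> error_fun b p \<omega> d\<omega>"

lemma block_in: "x \<in> X \<Longrightarrow> block b i x \<in> B i"
  by (simp add: block_prod_def)

lemma p_le_1: "p i \<le> 1"
  using p member_le_sum[of i UNIV p] by (auto simp: less_imp_le)

lemma total_norm_minus_commute: "total_norm b N (x - y) = total_norm b N (y - x)"
  using norm_on_minus_commute[OF mm.N mm.E block_in_block_space block_in_block_space]
  by (simp add: total_norm_def block_diff)

text \<open>Converts the decrease measured in the norm into a decrease of the error: blockwise the
  divergence is at most \<open>\<Lambda> / 2\<close> times the squared norm, and
  \<open>1 / p i\<close> is at most \<open>1 / \<pi>\<close>.\<close>

lemma error_fun_le_total_norm:
  assumes x: "x \<in> X" and z: "z \<in> X"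
  shows "2 * Min (range p) / Max (range L\<omega>) * err x z \<le> (total_norm b N (z - x))\<^sup>2"
proof -
  define \<pi> \<Lambda> where "\<pi> = Min (range p)" and "\<Lambda> = Max (range L\<omega>)"
  define D where "D = (\<lambda>i. bregman (\<omega> i) (d\<omega> i) (block b i x) (block b i z))"
  have D0: "0 \<le> D i" for i
    using mm.bregman_nonneg block_in[OF x] block_in[OF z] by (simp add: D_def)
  have D: "D i \<le> \<Lambda> / 2 * (N i (block b i (z - x)))\<^sup>2" for i
  proof -
    have "D i \<le> L\<omega> i / 2 * (N i (block b i (z - x)))\<^sup>2"
      using mm.upper[OF block_in[OF x] block_in[OF z], of i] by (simp add: D_def block_diff)
    also have "\<dots> \<le> \<Lambda> / 2 * (N i (block b i (z - x)))\<^sup>2"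
      by (intro mult_right_mono divide_right_mono) (auto simp: \<Lambda>_def)
    finally show ?thesis .
  qed
  have tn: "(total_norm b N (z - x))\<^sup>2 = (\<Sum>i\<in>UNIV. (N i (block b i (z - x)))\<^sup>2)"
    by (simp add: total_norm_def sum_nonneg)
  have err: "err x z = (\<Sum>i\<in>UNIV. inverse (p i) * D i)"
    by (simp add: error_fun_def D_def)
  have \<pi>: "\<pi> \<le> p i" "0 < \<pi>" for i
    using p(1) by (auto simp: \<pi>_def)
  have "2 * \<pi> / \<Lambda> * err x z \<le> (total_norm b N (z - x))\<^sup>2"
  proof (cases "0 < \<Lambda>")
    case True
    have "2 * \<pi> / \<Lambda> * err x z = (\<Sum>i\<in>UNIV. (\<pi> * inverse (p i)) * (2 / \<Lambda> * D i))"
      by (simp add: err sum_distrib_left mult.assoc mult.left_commute)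
    also have "\<dots> \<le> (\<Sum>i\<in>UNIV. 1 * (N i (block b i (z - x)))\<^sup>2)"
    proof (intro sum_mono mult_mono)
      fix i
      show "\<pi> * inverse (p i) \<le> 1" using \<pi> p(1)[of i] by (simp add: field_simps)
      show "2 / \<Lambda> * D i \<le> (N i (block b i (z - x)))\<^sup>2"
        using D[of i] True by (simp add: field_simps)
      show "0 \<le> 2 / \<Lambda> * D i" using D0 True by simp
    qed simp
    finally show ?thesis by (simp add: tn)
  next
    \<comment> \<open>No sign of \<open>L\<omega>\<close> is assumed. If
      \<open>\<Lambda> \<le> 0\<close>, the upper bounds force every divergence to vanish, so the
      left-hand side is 0 whatever the quotient is.\<close>
    case False
    have "D i = 0" for i
    proof -
      have "\<Lambda> / 2 * (N i (block b i (z - x)))\<^sup>2 \<le> 0"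
        using False by (intro mult_nonpos_nonneg) auto
      then show ?thesis using D[of i] D0[of i] by simp
    qed
    then show ?thesis by (simp add: err)
  qed
  then show ?thesis by (simp add: \<pi>_def \<Lambda>_def)
qed

lemma borel_measurable_bregman:
  "(\<lambda>x. bregman (\<omega> i) (d\<omega> i) x z) \<in> borel_measurable (restrict_space borel (B i))"
  by (intro borel_measurable_continuous_on_restrict mm.continuous_on_bregman)

lemma measurable_block_restrict: "block b i \<in> measurable (restrict_space borel X) (restrict_space borel (B i))"
  by (intro measurable_restrict_space2 measurable_restrict_space1)
    (auto simp: space_restrict_space block_in)

text \<open>Joint measurability in iterate and sample, by composing the jointly continuous prox
  mapping with \<open>G\<close>. It feeds both the induction over the iterates and the freezing of
  the current iterate.\<close>

lemma measurable_block_prox: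
  fixes G :: "real ^ 'n \<Rightarrow> 'y::topological_space \<Rightarrow> real ^ 'n"
  assumes G: "(\<lambda>(x, y). G x y) \<in> borel_measurable (restrict_space borel X \<Otimes>\<^sub>M borel)"
  shows "(\<lambda>(x, y). prox (\<omega> i) (d\<omega> i) (B i) (block b i x) (\<eta> *\<^sub>R block b i (G x y)))
     \<in> measurable (restrict_space borel X \<Otimes>\<^sub>M borel) (restrict_space borel (B i))"
proof -
  let ?R = "restrict_space borel X \<Otimes>\<^sub>M (borel :: 'y measure)"
  have [measurable]: "(\<lambda>q. G (fst q) (snd q)) \<in> borel_measurable ?R"
    using G by (simp add: split_beta)
  have [measurable]: "(\<lambda>q. block b i (fst q)) \<in> borel_measurable ?R"
    by (rule measurable_compose[OF measurable_fst measurable_restrict_space1[OF borel_measurable_block]])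
  have "(\<lambda>q. (block b i (fst q), \<eta> *\<^sub>R block b i (G (fst q) (snd q))))
      \<in> measurable ?R (restrict_space borel (B i \<times> UNIV))"
    by (rule measurable_restrict_space2)
      (auto simp: space_pair_measure space_restrict_space block_in)
  from measurable_compose[OF this borel_measurable_continuous_on_restrict[OF mm.continuous_on_prox]]
  show ?thesis
    by (intro measurable_restrict_space2)
      (auto simp: split_beta space_pair_measure space_restrict_space block_in intro!: mm.prox_in)
qed

text \<open>The integrand is the average over \<open>i\<close>, with weights \<open>p i\<close>, of the error after a step in block \<open>i\<close>.\<close>

lemma nn_integral_step_le:
  fixes \<Gamma> :: "'w \<Rightarrow> real ^ 'n"
  assumes M: "prob_space M" and x: "x \<in> X" and z: "z \<in> X" and \<eta>: "0 \<le> \<eta>" and \<mu>F: "0 \<le> \<mu>F"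
    and \<Gamma>: "integrable M \<Gamma>"
    and strong: "\<mu>F * (total_norm b N (z - x))\<^sup>2 \<le> (\<integral>w. \<Gamma> w \<partial>M) \<bullet> (x - z)"
    and dual: "\<And>i. integrable M (\<lambda>w. (dual_norm (block_space b i) (N i) (block b i (\<Gamma> w)))\<^sup>2)"
    and C: "\<And>i. (\<integral>w. (dual_norm (block_space b i) (N i) (block b i (\<Gamma> w)))\<^sup>2 \<partial>M) \<le> (C i)\<^sup>2"
  defines "R \<equiv> (1 - \<eta> * (2 * \<mu>F * Min (range p) / Max (range L\<omega>))) * err x z
      + \<eta>\<^sup>2 * (\<Sum>i\<in>UNIV. (C i)\<^sup>2 / (2 * \<mu>\<omega> i))"
  shows "0 \<le> R \<and>
    (\<integral>\<^sup>+ w. ennreal (\<Sum>j\<in>UNIV.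
        bregman (\<omega> j) (d\<omega> j) (prox (\<omega> j) (d\<omega> j) (B j) (block b j x) (\<eta> *\<^sub>R block b j (\<Gamma> w))) (block b j z)
        + (inverse (p j) - 1) * bregman (\<omega> j) (d\<omega> j) (block b j x) (block b j z)) \<partial>M) \<le> ennreal R"
proof -
  interpret prob_space M by (rule M)
  define e where "e = (\<lambda>j. bregman (\<omega> j) (d\<omega> j) (block b j x) (block b j z))"
  define a where "a = (\<lambda>j w. bregman (\<omega> j) (d\<omega> j)
    (prox (\<omega> j) (d\<omega> j) (B j) (block b j x) (\<eta> *\<^sub>R block b j (\<Gamma> w))) (block b j z))"
  define V where "V = (\<lambda>w. \<Sum>j\<in>UNIV. a j w + (inverse (p j) - 1) * e j)"
  define dn where "dn = (\<lambda>j w. (dual_norm (block_space b j) (N j) (block b j (\<Gamma> w)))\<^sup>2)"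
  define W where "W = (\<lambda>w. err x z + \<eta> * (\<Gamma> w \<bullet> (z - x)) + \<eta>\<^sup>2 * (\<Sum>j\<in>UNIV. dn j w / (2 * \<mu>\<omega> j)))"
  have V0: "0 \<le> V w" for w
  proof -
    \<comment> \<open>Probabilities are at most 1, so the weight of an unchanged block is
      nonnegative.\<close>
    have "0 \<le> inverse (p j) - 1" for j
      using p_le_1[of j] p(1)[of j] by (simp add: field_simps)
    then show ?thesis
      unfolding V_def a_def e_def
      by (intro sum_nonneg add_nonneg_nonneg mult_nonneg_nonneg mm.bregman_nonneg mm.prox_in
          block_in x z)
  qed
  have VW: "V w \<le> W w" for w
  proof -
    have "V w \<le> (\<Sum>j\<in>UNIV. inverse (p j) * e j + \<eta> * (block b j (\<Gamma> w) \<bullet> block b j (z - x))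
        + \<eta>\<^sup>2 * (dn j w / (2 * \<mu>\<omega> j)))"
      unfolding V_def
    proof (rule sum_mono)
      fix j
      \<comment> \<open>The prox inequality contributes \<open>e j\<close> once; with the weight
        \<open>inverse (p j) - 1\<close> this restores the weight \<open>inverse (p j)\<close> of
        the error function.\<close>
      show "a j w + (inverse (p j) - 1) * e j
        \<le> inverse (p j) * e j + \<eta> * (block b j (\<Gamma> w) \<bullet> block b j (z - x)) + \<eta>\<^sup>2 * (dn j w / (2 * \<mu>\<omega> j))"
        using mm.bregman_prox_le[OF block_in[OF x] block_in[OF z] \<eta>, of j "block b j (\<Gamma> w)"]
        by (simp add: a_def e_def dn_def block_diff left_diff_distrib)
    qed
    also have "\<dots> = W w"
      by (simp add: W_def sum.distrib sum_distrib_left[symmetric] sum_block_inner error_fun_def e_def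
          del: times_divide_eq_right)
    finally show ?thesis .
  qed
  have Wint: "integrable M W"
    unfolding W_def dn_def by (intro Bochner_Integration.integrable_add integrable_mult_right
        integrable_const Bochner_Integration.integrable_sum integrable_divide integrable_inner_left \<Gamma> dual)
  have "(\<integral>w. W w \<partial>M) = err x z + \<eta> * ((\<integral>w. \<Gamma> w \<partial>M) \<bullet> (z - x))
      + \<eta>\<^sup>2 * (\<Sum>j\<in>UNIV. (\<integral>w. dn j w \<partial>M) / (2 * \<mu>\<omega> j))"
    using \<Gamma> dual unfolding W_def dn_def by (simp add: prob_space)
  also have "\<dots> \<le> err x z - \<eta> * (\<mu>F * (2 * Min (range p) / Max (range L\<omega>) * err x z))
      + \<eta>\<^sup>2 * (\<Sum>j\<in>UNIV. (C j)\<^sup>2 / (2 * \<mu>\<omega> j))"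
  proof -
    have "\<mu>F * (2 * Min (range p) / Max (range L\<omega>) * err x z) \<le> \<mu>F * (total_norm b N (z - x))\<^sup>2"
      by (intro mult_left_mono error_fun_le_total_norm x z \<mu>F)
    also note strong
    finally have "\<eta> * (\<mu>F * (2 * Min (range p) / Max (range L\<omega>) * err x z))
        \<le> \<eta> * ((\<integral>w. \<Gamma> w \<partial>M) \<bullet> (x - z))"
      using \<eta> by (rule mult_left_mono)
    moreover have "(\<integral>w. \<Gamma> w \<partial>M) \<bullet> (x - z) = - ((\<integral>w. \<Gamma> w \<partial>M) \<bullet> (z - x))"
      by (simp add: inner_diff_right)
    moreover have "\<eta>\<^sup>2 * (\<Sum>j\<in>UNIV. (\<integral>w. dn j w \<partial>M) / (2 * \<mu>\<omega> j))
        \<le> \<eta>\<^sup>2 * (\<Sum>j\<in>UNIV. (C j)\<^sup>2 / (2 * \<mu>\<omega> j))"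
      using C mm.\<mu> by (intro mult_left_mono sum_mono divide_right_mono) (auto simp: dn_def less_imp_le)
    ultimately show ?thesis by simp
  qed
  also have "\<dots> = R" by (simp add: R_def algebra_simps)
  finally have WR: "(\<integral>w. W w \<partial>M) \<le> R" .
  have W0: "0 \<le> W w" for w using V0 VW order_trans by blast
  have "(\<integral>\<^sup>+ w. ennreal (V w) \<partial>M) \<le> (\<integral>\<^sup>+ w. ennreal (W w) \<partial>M)"
    by (intro nn_integral_mono ennreal_leI VW)
  also have "\<dots> = ennreal (\<integral>w. W w \<partial>M)"
    using Wint W0 by (intro nn_integral_eq_integral) auto
  also have "\<dots> \<le> ennreal R" using WR by (rule ennreal_leI)
  \<comment> \<open>The contraction factor may be negative, so \<open>0 \<le> R\<close> is not
    visible from its form; it follows because \<open>R\<close> dominates the integral of the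
    nonnegative function \<open>W\<close>.\<close>
  finally show ?thesis
    using order_trans[OF Bochner_Integration.integral_nonneg WR] W0
    by (simp add: V_def a_def e_def)
qed

end

section \<open>Back to real conditional expectations, and the recursion for the iterates\<close>

text \<open>The real conditional expectation is a difference of two nonnegative ones, and
  subtracting the negative part only lowers it. With \<open>0 \<le> r\<close> the value
  \<open>ennreal r\<close> is not truncated.\<close>

lemma real_cond_exp_le_of_nn_cond_exp:
  assumes "nn_cond_exp M P (\<lambda>w. ennreal (f w)) w \<le> ennreal r" "0 \<le> r"
  shows "real_cond_exp M P f w \<le> r"
proof -
  have "enn2real (nn_cond_exp M P (\<lambda>w. ennreal (f w)) w) \<le> r"
    using assms by (intro enn2real_leI)
  then show ?thesis
    unfolding real_cond_exp_def
    using enn2real_nonneg[of "nn_cond_exp M P (\<lambda>w. ennreal (- f w)) w"] by linarith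
qed

theorem lemma2:
  fixes b :: "'n::finite \<Rightarrow> 'l::finite"
    and B :: "'l \<Rightarrow> (real ^ 'n) set"
    and N :: "'l \<Rightarrow> real ^ 'n \<Rightarrow> real"
    and \<omega> :: "'l \<Rightarrow> real ^ 'n \<Rightarrow> real"
    and d\<omega> :: "'l \<Rightarrow> real ^ 'n \<Rightarrow> real ^ 'n"
    and \<mu>\<omega> L\<omega> p C :: "'l \<Rightarrow> real"
    and M :: "'w measure"
    and f :: "real ^ 'n \<Rightarrow> real ^ 'd::finite \<Rightarrow> real"
    and \<xi> :: "'w \<Rightarrow> real ^ 'd"
    and F :: "real ^ 'n \<Rightarrow> real"
    and \<mu>F :: real
    and G :: "real ^ 'n \<Rightarrow> real ^ 'd \<Rightarrow> real ^ 'n"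
    and g :: "real ^ 'n \<Rightarrow> real ^ 'n"
    and I :: "nat \<Rightarrow> 'w \<Rightarrow> 'l"
    and \<Xi> :: "nat \<Rightarrow> 'w \<Rightarrow> real ^ 'd"
    and \<eta> :: "nat \<Rightarrow> real"
    and \<beta>0 \<beta>star :: "real ^ 'n"
    and \<beta> :: "nat \<Rightarrow> 'w \<Rightarrow> real ^ 'n"
    and t :: nat
  assumes B: "\<And>i. B i \<subseteq> block_space b i \<and> B i \<noteq> {} \<and> closed (B i) \<and> convex (B i)"
    and N: "\<And>i. is_norm_on (block_space b i) (N i)"
    and \<omega>_C1: "\<And>i. C1_with_gradient (block_space b i) (\<omega> i) (d\<omega> i)"
    and \<mu>\<omega>: "\<And>i. \<mu>\<omega> i > 0"
    and \<omega>_bounds: "\<And>i x y. x \<in> B i \<Longrightarrow> y \<in> B i \<Longrightarrow>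
          \<mu>\<omega> i / 2 * (N i (y - x))\<^sup>2 \<le> bregman (\<omega> i) (d\<omega> i) x y \<and>
          bregman (\<omega> i) (d\<omega> i) x y \<le> L\<omega> i / 2 * (N i (y - x))\<^sup>2"
    and p: "\<And>i. p i > 0" "(\<Sum>i\<in>UNIV. p i) = 1"
    and M: "prob_space M"
    and \<xi>: "\<xi> \<in> borel_measurable M"
    and f_integrable: "\<And>x. x \<in> block_prod b B \<Longrightarrow> integrable M (\<lambda>w. f x (\<xi> w))"
    and F: "\<And>x. x \<in> block_prod b B \<Longrightarrow> F x = (\<integral>w. f x (\<xi> w) \<partial>M)"
    and F_convex: "convex_on (block_prod b B) F"
    and \<mu>F: "\<mu>F > 0"
    and F_strong: "strongly_convex_wrt (block_prod b B) (total_norm b N) \<mu>F F"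
    and \<beta>star: "is_arg_min F (\<lambda>x. x \<in> block_prod b B) \<beta>star"
    and G_measurable: "(\<lambda>(x, y). G x y)
          \<in> borel_measurable (restrict_space borel (block_prod b B) \<Otimes>\<^sub>M borel)"
    and G_subgradient: "AE y in distr M borel \<xi>. \<forall>x\<in>block_prod b B.
          G x y \<in> subdiff (block_prod b B) (\<lambda>z. f z y) x"
    and G_integrable: "\<And>x. x \<in> block_prod b B \<Longrightarrow> integrable M (\<lambda>w. G x (\<xi> w))"
    and G_unbiased: "\<And>x. x \<in> block_prod b B \<Longrightarrow>
          (\<integral>w. G x (\<xi> w) \<partial>M) = g x \<and> g x \<in> subdiff (block_prod b B) F x"
    and C: "\<And>i. C i > 0"
    and G_bound_integrable: "\<And>i x. x \<in> block_prod b B \<Longrightarrow>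
          integrable M (\<lambda>w. (dual_norm (block_space b i) (N i) (block b i (G x (\<xi> w))))\<^sup>2)"
    and G_bound: "\<And>i x. x \<in> block_prod b B \<Longrightarrow>
          (\<integral>w. (dual_norm (block_space b i) (N i) (block b i (G x (\<xi> w))))\<^sup>2 \<partial>M) \<le> (C i)\<^sup>2"
    and I_measurable: "\<And>s. I s \<in> measurable M (count_space UNIV)"
    and I_distr: "\<And>s i. measure M {w \<in> space M. I s w = i} = p i"
    and \<Xi>_measurable: "\<And>s. \<Xi> s \<in> borel_measurable M"
    and \<Xi>_distr: "\<And>s. distr M borel (\<Xi> s) = distr M borel \<xi>"
    and \<Xi>_indep: "\<And>s. prob_space.indep_set M
          (sets (sigma_vec M (\<Xi> s))) (sets (past M I \<Xi> s))"
    and I_indep: "\<And>s. prob_space.indep_set M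
          (sets (sigma_index M (I s)))
          (sets (sigma (space M) (sets (past M I \<Xi> s) \<union> sets (sigma_vec M (\<Xi> s)))))"
    and \<eta>: "\<And>s. \<eta> s > 0"
    and \<beta>0: "\<beta>0 \<in> block_prod b B"
    and \<beta>_init: "\<And>w. w \<in> space M \<Longrightarrow> \<beta> 0 w = \<beta>0"
    and \<beta>_step: "\<And>s w i. w \<in> space M \<Longrightarrow> block b i (\<beta> (Suc s) w) =
          (if i = I s w
           then prox (\<omega> i) (d\<omega> i) (B i) (block b i (\<beta> s w))
                  (\<eta> s *\<^sub>R block b i (G (\<beta> s w) (\<Xi> s w)))
           else block b i (\<beta> s w))"
  shows "AE w in M.
    real_cond_exp M (past M I \<Xi> t) (\<lambda>w. error_fun b p \<omega> d\<omega> (\<beta> (Suc t) w) \<beta>star) w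
      \<le> (1 - \<eta> t * (2 * \<mu>F * Min (range p) / Max (range L\<omega>)))
            * error_fun b p \<omega> d\<omega> (\<beta> t w) \<beta>star
        + (\<eta> t)\<^sup>2 * (\<Sum>i\<in>UNIV. (C i)\<^sup>2 / (2 * \<mu>\<omega> i))"
proof -
  interpret prob_space M by (rule M)
  interpret block_mirror_maps b B N \<omega> d\<omega> \<mu>\<omega> L\<omega> p
    using B N \<omega>_C1 \<mu>\<omega> \<omega>_bounds p
    by unfold_locales (auto simp: subspace_block_space)
  let ?R = "restrict_space borel X"
  let ?P = "past M I \<Xi>"
  define h where "h = (\<lambda>s i x y. prox (\<omega> i) (d\<omega> i) (B i) (block b i x) (\<eta> s *\<^sub>R block b i (G x y)))"
  have h_meas: "(\<lambda>(x, y). h s i x y) \<in> measurable (?R \<Otimes>\<^sub>M borel) (restrict_space borel (B i))" for s i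
    unfolding h_def by (rule measurable_block_prox[OF G_measurable])
  have step: "block b i (\<beta> (Suc s) w) = (if i = I s w then h s i (\<beta> s w) (\<Xi> s w) else block b i (\<beta> s w))"
    if "w \<in> space M" for s w i
    using \<beta>_step[OF that] by (simp add: h_def)
  have \<beta>_in: "\<beta> s w \<in> X" if w: "w \<in> space M" for s w
  proof (induction s)
    case 0
    then show ?case using \<beta>_init[OF w] \<beta>0 by simp
  next
    case (Suc s)
    then have "block b i (\<beta> (Suc s) w) \<in> B i" for i
      using step[OF w] by (auto simp: h_def block_in intro: mm.prox_in)
    then show ?case by (simp add: block_prod_def)
  qed
  \<comment> \<open>The iterate at time \<open>s\<close> uses indices and samples strictly before
    \<open>s\<close>; \<open>I s\<close> and \<open>\<Xi> s\<close> enter with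
    \<open>?P (Suc s)\<close>, as the next iterate requires.\<close>
  have \<beta>_meas: "\<beta> s \<in> measurable (?P s) ?R" for s
  proof (induction s)
    case 0
    have "\<beta> 0 \<in> measurable (?P 0) ?R \<longleftrightarrow> (\<lambda>_. \<beta>0) \<in> measurable (?P 0) ?R"
      by (rule measurable_cong) (simp add: space_past \<beta>_init)
    then show ?case using \<beta>0 by (simp add: space_restrict_space)
  next
    case (Suc s)
    have \<beta>s: "\<beta> s \<in> measurable (?P (Suc s)) ?R"
      by (rule measurable_from_subalg[OF subalgebra_past_Suc Suc.IH])
    have [measurable]: "I s \<in> measurable (?P (Suc s)) (count_space UNIV)"
      by (rule measurable_past_index)
    have [measurable]: "(\<lambda>w. h s i (\<beta> s w) (\<Xi> s w)) \<in> borel_measurable (?P (Suc s))" for i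
      using measurable_compose[OF measurable_Pair[OF \<beta>s measurable_past_vec] h_meas]
      by (simp add: measurable_restrict_space2_iff)
    have [measurable]: "(\<lambda>w. block b i (\<beta> s w)) \<in> borel_measurable (?P (Suc s))" for i
      using measurable_compose[OF \<beta>s measurable_block_restrict]
      by (simp add: measurable_restrict_space2_iff)
    have "(\<lambda>w. \<Sum>i\<in>UNIV. if i = I s w then h s i (\<beta> s w) (\<Xi> s w) else block b i (\<beta> s w))
        \<in> borel_measurable (?P (Suc s))"
      by measurable
    \<comment> \<open>The scheme prescribes blocks, and the iterate is recovered as the sum of its
      blocks.\<close>
    moreover have "(\<Sum>i\<in>UNIV. if i = I s w then h s i (\<beta> s w) (\<Xi> s w) else block b i (\<beta> s w))
        = \<beta> (Suc s) w" if "w \<in> space (?P (Suc s))" for w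
      using that sum_block[of b "\<beta> (Suc s) w"] by (simp add: step space_past)
    ultimately have "\<beta> (Suc s) \<in> borel_measurable (?P (Suc s))"
      by (simp cong: measurable_cong)
    then show ?case
      using \<beta>_in by (intro measurable_restrict_space2) (auto simp: space_past)
  qed

  define e where "e = (\<lambda>j x. bregman (\<omega> j) (d\<omega> j) (block b j x) (block b j \<beta>star))"
  define a where "a = (\<lambda>j x y. bregman (\<omega> j) (d\<omega> j) (h t j x y) (block b j \<beta>star))"
  have \<beta>star_in: "\<beta>star \<in> X" using \<beta>star unfolding is_arg_min_def by blast
  have e0: "0 \<le> e j x" if "x \<in> X" for j x
    unfolding e_def by (intro mm.bregman_nonneg block_in that \<beta>star_in)
  have a0: "0 \<le> a j x y" if "x \<in> X" for j x y
    unfolding a_def h_def by (intro mm.bregman_nonneg mm.prox_in block_in that \<beta>star_in)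
  have e_meas: "e j \<in> borel_measurable ?R" for j
    unfolding e_def by (rule measurable_compose[OF measurable_block_restrict borel_measurable_bregman])
  have a_meas: "(\<lambda>(x, y). a j x y) \<in> borel_measurable (?R \<Otimes>\<^sub>M borel)" for j
    using measurable_compose[OF h_meas borel_measurable_bregman, where i1=j]
    unfolding a_def by (simp add: split_beta)

  define P where "P = ?P t"
  \<comment> \<open>The past together with the current sample but without the current index.
    Conditioning runs in two stages: the index is averaged out given \<open>Q\<close>, then the
    sample given \<open>P\<close>.\<close>
  define Q where "Q = sigma (space M) (sets P \<union> sets (sigma_vec M (\<Xi> t)))"
  have spP: "space P = space M" by (simp add: P_def space_past)
  have subP: "subalgebra M P"
    unfolding P_def by (rule subalgebra_past[OF I_measurable \<Xi>_measurable])
  have setsQ: "sets Q = sigma_sets (space M) (sets P \<union> sets (sigma_vec M (\<Xi> t)))"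
    unfolding Q_def
    by (intro sets_measure_of) (auto simp: spP[symmetric] dest: sets.sets_into_space[THEN subsetD])
  have spQ: "space Q = space M" by (simp add: Q_def space_measure_of_conv)
  have subQ: "subalgebra M Q"
    using subP sets_vimage_algebra_subset[OF \<Xi>_measurable[of t]]
    unfolding subalgebra_def setsQ spQ by (auto intro!: sets.sigma_sets_subset)
  have subPQ: "subalgebra Q P"
    unfolding subalgebra_def spP spQ setsQ by auto
  interpret P: finite_measure_subalgebra M P by unfold_locales (rule subP)

  have \<beta>P: "\<beta> t \<in> measurable P ?R" unfolding P_def by (rule \<beta>_meas)
  have \<beta>Q: "\<beta> t \<in> measurable Q ?R" by (rule measurable_from_subalg[OF subPQ \<beta>P])
  have \<Xi>Q: "\<Xi> t \<in> borel_measurable Q"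
    by (rule measurable_if_sets_vimage) (auto simp: spQ setsQ)
  have [measurable]: "(\<lambda>w. e j (\<beta> t w)) \<in> borel_measurable Q" for j
    by (rule measurable_compose[OF \<beta>Q e_meas])
  have [measurable]: "(\<lambda>w. a j (\<beta> t w) (\<Xi> t w)) \<in> borel_measurable Q" for j
    using measurable_compose[OF measurable_Pair[OF \<beta>Q \<Xi>Q] a_meas] by simp

  \<comment> \<open>\<open>U\<close> is the error after updating block \<open>i\<close> from iterate
    \<open>x\<close> with sample \<open>y\<close>; \<open>V\<close> is its average over the random
    index.\<close>
  define U where "U = (\<lambda>x y i. \<Sum>j\<in>UNIV. inverse (p j) * (if j = i then a j x y else e j x))"
  define V where "V = (\<lambda>x y. \<Sum>j\<in>UNIV. a j x y + (inverse (p j) - 1) * e j x)"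
  have U0: "0 \<le> U x y i" if "x \<in> X" for x y i
    unfolding U_def using p(1) e0[OF that] a0[OF that]
    by (intro sum_nonneg mult_nonneg_nonneg) (auto simp: less_imp_le)
  have UV: "(\<Sum>i\<in>UNIV. p i * U x y i) = V x y" for x y
  proof -
    have "(\<Sum>i\<in>UNIV. p i * U x y i)
        = (\<Sum>j\<in>UNIV. inverse (p j) * (\<Sum>i\<in>UNIV. p i * (if j = i then a j x y else e j x)))"
      unfolding U_def sum_distrib_left by (subst sum.swap) (simp add: mult_ac)
    also have "\<dots> = V x y"
      unfolding V_def
    proof (rule sum.cong[OF refl])
      fix j
      \<comment> \<open>Block \<open>j\<close> changes only when it is drawn: the weights sum to 1
        on the old divergence, and the change enters with weight \<open>p j\<close>, which the
        factor \<open>inverse (p j)\<close> then cancels.\<close>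
      have "(\<Sum>i\<in>UNIV. p i * (if j = i then a j x y else e j x))
          = (\<Sum>i\<in>UNIV. p i * e j x + (if j = i then p i * (a j x y - e j x) else 0))"
        by (intro sum.cong) (auto simp: algebra_simps)
      also have "\<dots> = e j x + p j * (a j x y - e j x)"
        using p(2) by (simp add: sum.distrib sum_distrib_right[symmetric] sum.delta)
      finally show "inverse (p j) * (\<Sum>i\<in>UNIV. p i * (if j = i then a j x y else e j x))
          = a j x y + (inverse (p j) - 1) * e j x"
        using p(1)[of j] by (simp add: field_simps)
    qed
    finally show ?thesis .
  qed
  have next_err: "err (\<beta> (Suc t) w) \<beta>star = U (\<beta> t w) (\<Xi> t w) (I t w)" if "w \<in> space M" for w
    unfolding error_fun_def U_def using step[OF that]
    by (intro sum.cong) (auto simp: a_def e_def)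

  let ?L = "\<lambda>w. ennreal (err (\<beta> (Suc t) w) \<beta>star)"
  let ?U = "\<lambda>w. ennreal (U (\<beta> t w) (\<Xi> t w) (I t w))"
  let ?V = "\<lambda>w. ennreal (V (\<beta> t w) (\<Xi> t w))"
  have IM: "I t \<in> measurable M (count_space UNIV)" by (rule I_measurable)
  have Q_meas: "(\<lambda>(w, i). ennreal (U (\<beta> t w) (\<Xi> t w) i)) \<in> borel_measurable (Q \<Otimes>\<^sub>M count_space UNIV)"
    unfolding U_def by measurable
  have U_measM: "?U \<in> borel_measurable M"
    using measurable_compose[OF measurable_Pair[OF measurable_from_subalg[OF subQ measurable_ident_sets[OF refl]] IM] Q_meas]
    by simp
  have VQ: "?V \<in> borel_measurable Q" unfolding V_def by measurable
  have VM: "?V \<in> borel_measurable M" by (rule measurable_from_subalg[OF subQ VQ])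
  \<comment> \<open>First stage: given \<open>Q\<close>, iterate and sample are frozen and only the
    independent index is averaged.\<close>
  have 1: "AE w in M. nn_cond_exp M Q ?U w = ?V w"
  proof -
    have "AE w in M. nn_cond_exp M Q ?U w
        = (\<integral>\<^sup>+ i. ennreal (U (\<beta> t w) (\<Xi> t w) i) \<partial>distr M (count_space UNIV) (I t))"
      using I_indep[of t] by (intro nn_cond_exp_freeze subQ IM Q_meas) (simp add: Q_def P_def)
    moreover have "(\<integral>\<^sup>+ i. ennreal (U (\<beta> t w) (\<Xi> t w) i) \<partial>distr M (count_space UNIV) (I t)) = ?V w"
      if "w \<in> space M" for w
      using U0[OF \<beta>_in[OF that]] p(1)
      by (simp add: nn_integral_finite_valued[OF IM] I_distr UV[symmetric] ennreal_mult[symmetric]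
          less_imp_le)
    ultimately show ?thesis by (auto elim!: AE_mp)
  qed
  \<comment> \<open>Second stage: given \<open>P\<close>, only the iterate is frozen and the fresh
    sample is integrated out.\<close>
  have 2: "AE w in M. nn_cond_exp M P ?V w
      = (\<integral>\<^sup>+ y. ennreal (V (\<beta> t w) y) \<partial>distr M borel (\<Xi> t))"
  proof (rule nn_cond_exp_freeze[OF subP \<Xi>_measurable])
    show "indep_set (sets (sigma_vec M (\<Xi> t))) (sets P)"
      unfolding P_def by (rule \<Xi>_indep)
    have [measurable]: "(\<lambda>q. e j (\<beta> t (fst q))) \<in> borel_measurable (P \<Otimes>\<^sub>M borel)" for j
      by (rule measurable_compose[OF measurable_compose[OF measurable_fst \<beta>P] e_meas])
    have [measurable]: "(\<lambda>q. a j (\<beta> t (fst q)) (snd q)) \<in> borel_measurable (P \<Otimes>\<^sub>M borel)" for j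
      using measurable_compose[OF measurable_Pair[OF measurable_compose[OF measurable_fst \<beta>P] measurable_snd] a_meas]
      by simp
    show "(\<lambda>(w, y). ennreal (V (\<beta> t w) y)) \<in> borel_measurable (P \<Otimes>\<^sub>M borel)"
      unfolding V_def split_beta by measurable
  qed
  \<comment> \<open>The tower property along \<open>P\<close>, \<open>Q\<close>, \<open>M\<close>
    joins the two stages.\<close>
  have 3: "AE w in M. nn_cond_exp M P ?U w
      = (\<integral>\<^sup>+ y. ennreal (V (\<beta> t w) y) \<partial>distr M borel (\<Xi> t))"
    using P.nn_cond_exp_nested_subalg[OF subQ subPQ U_measM]
      P.nn_cond_exp_cong[OF 1 _ VM] 2
    by (auto elim!: AE_mp)
  have L_U: "AE w in M. ?L w = ?U w" by (simp add: next_err)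
  have L_meas: "?L \<in> borel_measurable M"
    using U_measM by (simp add: next_err cong: measurable_cong)
  have 4: "AE w in M. nn_cond_exp M P ?L w = nn_cond_exp M P ?U w"
    by (rule P.nn_cond_exp_cong[OF L_U L_meas U_measM])

  let ?bound = "\<lambda>x. (1 - \<eta> t * (2 * \<mu>F * Min (range p) / Max (range L\<omega>))) * err x \<beta>star
        + (\<eta> t)\<^sup>2 * (\<Sum>i\<in>UNIV. (C i)\<^sup>2 / (2 * \<mu>\<omega> i))"
  \<comment> \<open>With the iterate frozen at a fixed feasible \<open>x\<close>, the sample has the
    law of \<open>\<xi>\<close>, so the unbiasedness and second-moment assumptions on
    \<open>G\<close> apply pointwise in \<open>x\<close>.\<close>
  have bound: "0 \<le> ?bound x \<and> (\<integral>\<^sup>+ y. ennreal (V x y) \<partial>distr M borel (\<Xi> t)) \<le> ennreal (?bound x)"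
    if x: "x \<in> X" for x
  proof -
    have Vx: "(\<lambda>y. ennreal (V x y)) \<in> borel_measurable borel"
    proof -
      have [measurable]: "(\<lambda>y. a j x y) \<in> borel_measurable borel" for j
        using measurable_Pair2[OF a_meas, of x j] x by (simp add: space_restrict_space)
      show ?thesis unfolding V_def by measurable
    qed
    have "\<mu>F * (total_norm b N (\<beta>star - x))\<^sup>2 \<le> (\<integral>w. G x (\<xi> w) \<partial>M) \<bullet> (x - \<beta>star)"
      using G_unbiased[OF x]
      by (intro strongly_convex_wrt_inner_ge[OF F_strong \<beta>star x] total_norm_minus_commute) simp
    from nn_integral_step_le[OF M x \<beta>star_in _ _ G_integrable[OF x] this
        G_bound_integrable[OF x] G_bound[OF x], of "\<eta> t"]
    have "0 \<le> ?bound x \<and> (\<integral>\<^sup>+ w. ennreal (V x (\<xi> w)) \<partial>M) \<le> ennreal (?bound x)"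
      using \<eta>[of t] \<mu>F by (simp add: V_def a_def e_def h_def)
    then show ?thesis
      using \<xi> Vx by (simp add: \<Xi>_distr nn_integral_distr)
  qed

  show ?thesis
    using 3 4 AE_space
  proof eventually_elim
    case (elim w)
    then show ?case
      using bound[OF \<beta>_in[OF elim(3)]]
      by (intro real_cond_exp_le_of_nn_cond_exp) (auto simp: P_def)
  qed
qed

end
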